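(* Let $\mathcal{D}\in\mathbb{R}^{I_1\times\cdots\times I_N}$ and $\mathbf{A}_n\in\mathbb{R}^{I_n\times I_n}$ ($n=1,\dots,N$) be given, and assume that the Sylvester tensor equation $\mathcal{L}(\mathcal{X})=\mathcal{D}$ is consistent. Then for any initial tensor $\mathcal{X}_0\in\mathbb{R}^{I_1\times\cdots\times I_N}$, the TBiCOR algorithm converges to an exact solution of $\mathcal{L}(\mathcal{X})=\mathcal{D}$ in at most $M=I_1\times I_2\times\cdots\times I_N$ iteration steps in the absence of roundoff errors.
   Context: For $\mathcal{X}\in\mathbb{R}^{I_1\times\cdots\times I_N}$ and $\mathbf{A}\in\mathbb{R}^{J\times I_n}$, the $n$-mode product is $(\mathcal{X}\times_n\mathbf{A})_{i_1\dots i_{n-1}\,j\,i_{n+1}\dots i_N}=\sum_{i_n=1}^{I_n}x_{i_1\dots i_N}a_{j i_n}$. The inner product is $\langle\mathcal{X},\mathcal{Y}\rangle=\sum_{i_1,\dots,i_N}x_{i_1\dots i_N}y_{i_1\dots i_N}$. Define the linear operators on $\mathbb{R}^{I_1\times\cdots\times I_N}$ $$\mathcal{L}(\mathcal{X})=\mathcal{X}\times_1\mathbf{A}_1+\cdots+\mathcal{X}\times_N\mathbf{A}_N,\qquad \mathcal{L}^T(\mathcal{X})=\mathcal{X}\times_1\mathbf{A}_1^T+\cdots+\mathcal{X}\times_N\mathbf{A}_N^T .$$ The equation $\mathcal{L}(\mathcal{X})=\mathcal{D}$ is consistent if it has at least one solution $\mathcal{X}\in\mathbb{R}^{I_1\times\cdots\times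 I_N}$. TBiCOR algorithm (tensor biconjugate $\mathcal{L}$-orthogonal residual algorithm): given an initial guess $\mathcal{X}_0$, set $\mathcal{R}_0=\mathcal{D}-\mathcal{L}(\mathcal{X}_0)$, $\mathcal{R}_0^*=\mathcal{L}(\mathcal{R}_0)$, $\mathcal{P}_{-1}^*=\mathcal{P}_{-1}=0$, $\beta_{-1}=0$. For $n=0,1,\dots$, until convergence: $\mathcal{P}_n=\mathcal{R}_n+\beta_{n-1}\mathcal{P}_{n-1}$; $\mathcal{P}_n^*=\mathcal{R}_n^*+\beta_{n-1}\mathcal{P}_{n-1}^*$; $\mathcal{S}_n=\mathcal{L}(\mathcal{P}_n)$; $\mathcal{S}_n^*=\mathcal{L}^T(\mathcal{P}_n^* )$; $\mathcal{T}_n=\mathcal{L}(\mathcal{R}_n)$; $\alpha_n=\langle\mathcal{R}_n^*,\mathcal{T}_n\rangle/\langle\mathcal{S}_n^*,\mathcal{S}_n\rangle$; $\mathcal{X}_{n+1}=\mathcal{X}_n+\alpha_n\mathcal{P}_n$; $\mathcal{R}_{n+1}=\mathcal{R}_n-\alpha_n\mathcal{S}_n$; $\mathcal{R}_{n+1}^*=\mathcal{R}_n^*-\alpha_n\mathcal{S}_n^*$; $\mathcal{T}_{n+1}=\mathcal{L}(\mathcal{R}_{n+1})$; $\beta_n=\langle\mathcal{R}_{n+1}^*,\mathcal{T}_{n+1}\rangle/\langle\mathcal{R}_n^*,\mathcal{T}_n\rangle$.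
   Formalization: The formal statement adds that the algorithm does not break down: as long as the residual R_n is nonzero, the divisors ⟨S*_n,S_n⟩ and ⟨R*_n,T_n⟩ are nonzero; without this the claim fails, e.g. N=1 and A a rotation by 90 degrees, where α_0 divides by zero. *)

theory Defs
  imports "HOL-Library.FuncSet" "Jordan_Normal_Form.Matrix"
begin

text \<open>
  Modes are numbered \<open>1, \<dots>, N\<close>; mode \<open>n\<close> has size \<open>I n\<close>. Positions inside a mode are
  counted from \<open>0\<close>, as in the matrix library. A tensor is a function on multi-indices that is
  \<open>undefined\<close> outside the index set, so that HOL equality is equality of tensors; accordingly
  every operation restricts its result to the index set.
\<close>

type_synonym tensor = "(nat \<Rightarrow> nat) \<Rightarrow> real"

definition tindex :: "nat \<Rightarrow> (nat \<Rightarrow> nat) \<Rightarrow> (nat \<Rightarrow> nat) set" where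
  "tindex N I = (\<Pi>\<^sub>E n\<in>{1..N}. {..<I n})"

definition tensors :: "nat \<Rightarrow> (nat \<Rightarrow> nat) \<Rightarrow> tensor set" where
  "tensors N I = (tindex N I \<rightarrow>\<^sub>E UNIV)"

definition tzero :: "nat \<Rightarrow> (nat \<Rightarrow> nat) \<Rightarrow> tensor" where
  "tzero N I = (\<lambda>i\<in>tindex N I. 0)"

definition tadd :: "nat \<Rightarrow> (nat \<Rightarrow> nat) \<Rightarrow> tensor \<Rightarrow> tensor \<Rightarrow> tensor" where
  "tadd N I X Y = (\<lambda>i\<in>tindex N I. X i + Y i)"

definition tdiff :: "nat \<Rightarrow> (nat \<Rightarrow> nat) \<Rightarrow> tensor \<Rightarrow> tensor \<Rightarrow> tensor" where
  "tdiff N I X Y = (\<lambda>i\<in>tindex N I. X i - Y i)"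

definition tscale :: "nat \<Rightarrow> (nat \<Rightarrow> nat) \<Rightarrow> real \<Rightarrow> tensor \<Rightarrow> tensor" where
  "tscale N I c X = (\<lambda>i\<in>tindex N I. c * X i)"

definition tinner :: "nat \<Rightarrow> (nat \<Rightarrow> nat) \<Rightarrow> tensor \<Rightarrow> tensor \<Rightarrow> real" where
  "tinner N I X Y = (\<Sum>i\<in>tindex N I. X i * Y i)"

text \<open>For \<open>X\<close> of format \<open>I\<close> and a \<open>J \<times> I n\<close> matrix \<open>B\<close>, the result has format \<open>I(n := J)\<close>.\<close>

definition mode_prod ::
  "nat \<Rightarrow> (nat \<Rightarrow> nat) \<Rightarrow> tensor \<Rightarrow> nat \<Rightarrow> real mat \<Rightarrow> tensor" where
  "mode_prod N I X n B =
     (\<lambda>j\<in>tindex N (I(n := dim_row B)). \<Sum>k<I n. X (j(n := k)) * B $$ (j n, k))"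

definition sylv :: "nat \<Rightarrow> (nat \<Rightarrow> nat) \<Rightarrow> (nat \<Rightarrow> real mat) \<Rightarrow> tensor \<Rightarrow> tensor" where
  "sylv N I A X = (\<lambda>i\<in>tindex N I. \<Sum>n=1..N. mode_prod N I X n (A n) i)"

definition sylvT :: "nat \<Rightarrow> (nat \<Rightarrow> nat) \<Rightarrow> (nat \<Rightarrow> real mat) \<Rightarrow> tensor \<Rightarrow> tensor" where
  "sylvT N I A X = (\<lambda>i\<in>tindex N I. \<Sum>n=1..N. mode_prod N I X n (transpose_mat (A n)) i)"

definition sylv_solution ::
  "nat \<Rightarrow> (nat \<Rightarrow> nat) \<Rightarrow> (nat \<Rightarrow> real mat) \<Rightarrow> tensor \<Rightarrow> tensor \<Rightarrow> bool" where
  "sylv_solution N I A D X \<longleftrightarrow> X \<in> tensors N I \<and> sylv N I A X = D"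

definition sylv_consistent ::
  "nat \<Rightarrow> (nat \<Rightarrow> nat) \<Rightarrow> (nat \<Rightarrow> real mat) \<Rightarrow> tensor \<Rightarrow> bool" where
  "sylv_consistent N I A D \<longleftrightarrow> (\<exists>X. sylv_solution N I A D X)"

text \<open>
  The data available at the start of loop pass \<open>n\<close>: \<open>X\<^sub>n\<close>, \<open>R\<^sub>n\<close>, \<open>R\<^sub>n*\<close>, and, from the
  preceding pass, \<open>P\<^sub>n\<^sub>-\<^sub>1\<close>, \<open>P\<^sub>n\<^sub>-\<^sub>1*\<close>, \<open>\<beta>\<^sub>n\<^sub>-\<^sub>1\<close>.
\<close>

record tbicor_state =
  iterX :: tensor
  resR :: tensor
  resR' :: tensor
  prevP :: tensor
  prevP' :: tensor
  prev\<beta> :: real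

definition tbicor_init ::
  "nat \<Rightarrow> (nat \<Rightarrow> nat) \<Rightarrow> (nat \<Rightarrow> real mat) \<Rightarrow> tensor \<Rightarrow> tensor \<Rightarrow> tbicor_state" where
  "tbicor_init N I A D X0 =
     (let R0 = tdiff N I D (sylv N I A X0)
      in \<lparr>iterX = X0, resR = R0, resR' = sylv N I A R0,
          prevP = tzero N I, prevP' = tzero N I, prev\<beta> = 0\<rparr>)"

definition dirP :: "nat \<Rightarrow> (nat \<Rightarrow> nat) \<Rightarrow> tbicor_state \<Rightarrow> tensor" where
  "dirP N I s = tadd N I (resR s) (tscale N I (prev\<beta> s) (prevP s))"

definition dirP' :: "nat \<Rightarrow> (nat \<Rightarrow> nat) \<Rightarrow> tbicor_state \<Rightarrow> tensor" where
  "dirP' N I s = tadd N I (resR' s) (tscale N I (prev\<beta> s) (prevP' s))"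

text \<open>
  The two inner products that occur as divisors: \<open>\<langle>R\<^sub>n*, T\<^sub>n\<rangle>\<close>, the numerator of \<open>\<alpha>\<^sub>n\<close> and the
  divisor in \<open>\<beta>\<^sub>n\<close>, and \<open>\<langle>S\<^sub>n*, S\<^sub>n\<rangle>\<close>, the divisor in \<open>\<alpha>\<^sub>n\<close>.
\<close>

definition innerRT :: "nat \<Rightarrow> (nat \<Rightarrow> nat) \<Rightarrow> (nat \<Rightarrow> real mat) \<Rightarrow> tbicor_state \<Rightarrow> real" where
  "innerRT N I A s = tinner N I (resR' s) (sylv N I A (resR s))"

definition innerSS :: "nat \<Rightarrow> (nat \<Rightarrow> nat) \<Rightarrow> (nat \<Rightarrow> real mat) \<Rightarrow> tbicor_state \<Rightarrow> real" where
  "innerSS N I A s = tinner N I (sylvT N I A (dirP' N I s)) (sylv N I A (dirP N I s))"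

definition tbicor_step ::
  "nat \<Rightarrow> (nat \<Rightarrow> nat) \<Rightarrow> (nat \<Rightarrow> real mat) \<Rightarrow> tbicor_state \<Rightarrow> tbicor_state" where
  "tbicor_step N I A s =
     (let P = dirP N I s;
          P' = dirP' N I s;
          S = sylv N I A P;
          S' = sylvT N I A P';
          \<alpha> = innerRT N I A s / innerSS N I A s;
          X1 = tadd N I (iterX s) (tscale N I \<alpha> P);
          R1 = tdiff N I (resR s) (tscale N I \<alpha> S);
          R1' = tdiff N I (resR' s) (tscale N I \<alpha> S');
          T1 = sylv N I A R1;
          \<beta> = tinner N I R1' T1 / innerRT N I A s
      in \<lparr>iterX = X1, resR = R1, resR' = R1', prevP = P, prevP' = P', prev\<beta> = \<beta>\<rparr>)"

definition tbicor ::
  "nat \<Rightarrow> (nat \<Rightarrow> nat) \<Rightarrow> (nat \<Rightarrow> real mat) \<Rightarrow> tensor \<Rightarrow> tensor \<Rightarrow> nat \<Rightarrow> tbicor_state" where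
  "tbicor N I A D X0 n = (tbicor_step N I A ^^ n) (tbicor_init N I A D X0)"

definition tbicor_converged ::
  "nat \<Rightarrow> (nat \<Rightarrow> nat) \<Rightarrow> (nat \<Rightarrow> real mat) \<Rightarrow> tensor \<Rightarrow> tensor \<Rightarrow> nat \<Rightarrow> bool" where
  "tbicor_converged N I A D X0 n \<longleftrightarrow> resR (tbicor N I A D X0 n) = tzero N I"

text \<open>
  The recursion above is total because \<open>x / 0 = 0\<close> in HOL. It describes the actual algorithm only
  as long as no division by zero occurs in a pass that is carried out, i.e. in one
  that is entered with a nonzero residual.
\<close>

definition tbicor_no_breakdown ::
  "nat \<Rightarrow> (nat \<Rightarrow> nat) \<Rightarrow> (nat \<Rightarrow> real mat) \<Rightarrow> tensor \<Rightarrow> tensor \<Rightarrow> bool" where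
  "tbicor_no_breakdown N I A D X0 \<longleftrightarrow>
     (\<forall>n. \<not> tbicor_converged N I A D X0 n \<longrightarrow>
        innerSS N I A (tbicor N I A D X0 n) \<noteq> 0 \<and>
        innerRT N I A (tbicor N I A D X0 n) \<noteq> 0)"

end

theory Submission
  imports Defs "Jordan_Normal_Form.Determinant"
begin

text \<open>
  Write \<open>L\<close> for \<open>sylv N I A\<close>. As \<open>sylvT N I A\<close> is the adjoint of \<open>L\<close>, the recurrences of the
  algorithm turn into scalar recurrences between the numbers \<open>\<langle>R\<^sub>i*, L R\<^sub>j\<rangle>\<close>,
  \<open>\<langle>L\<^sup>T P\<^sub>i*, L P\<^sub>j\<rangle>\<close> and the two mixed tables \<open>\<langle>L\<^sup>T P\<^sub>i*, L R\<^sub>j\<rangle>\<close>,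
  \<open>\<langle>L\<^sup>T R\<^sub>i*, L P\<^sub>j\<rangle>\<close>. An induction on these tables alone shows that the coefficients \<open>\<alpha>\<close> and
  \<open>\<beta>\<close> are exactly those that make the first two tables diagonal (\<open>biconjugacy\<close>), as long as
  no diagonal entry vanishes.

  Suppose that the residuals \<open>R\<^sub>0, \<dots>, R\<^sub>M\<close> were all nonzero. Then no pass so far has broken down, so
  the functionals \<open>\<langle>R\<^sub>i*, L _\<rangle>\<close> and the vectors \<open>R\<^sub>j\<close>, for \<open>i, j \<le> M\<close>, are biorthogonal
  with nonzero diagonal. But \<open>M\<close>, the number of multi-indices, is the dimension of the
  space, which has no biorthogonal system of \<open>M + 1\<close> vectors (\<open>biorthogonal_card_le\<close>). Hence some
  \<open>R\<^sub>n\<close> with \<open>n \<le> M\<close> is zero, and since \<open>R\<^sub>n\<close> is always the true residual of \<open>X\<^sub>n\<close>,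
  the iterate \<open>X\<^sub>n\<close> is a solution.
\<close>

section \<open>Biconjugacy from scalar recurrences\<close>

text \<open>
  One induction step, for the new row \<open>n + 1\<close> only. The new column is the same statement for the
  transposed tables, because transposition exchanges \<open>d\<close> with \<open>e\<close> and the row recurrences
  with the column recurrences.
\<close>

lemma biconjugacy_new_row:
  fixes b c d e :: "nat \<Rightarrow> nat \<Rightarrow> real" and \<alpha> \<beta> :: "nat \<Rightarrow> real"
  assumes b_row: "\<And>i j. b (Suc i) j = b i j - \<alpha> i * d i j"
    and b_col: "\<And>i j. b i (Suc j) = b i j - \<alpha> j * e i j"
    and c_row: "\<And>i j. c (Suc i) j = e (Suc i) j + \<beta> i * c i j"
    and c_col0: "\<And>i. c i 0 = d i 0"
    and c_col: "\<And>i j. c i (Suc j) = d i (Suc j) + \<beta> j * c i j"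
    and \<alpha>: "\<And>i. \<alpha> i = b i i / c i i"
    and \<beta>: "\<And>i. \<beta> i = b (Suc i) (Suc i) / b i i"
    and nz: "\<And>i. i \<le> n \<Longrightarrow> b i i \<noteq> 0 \<and> c i i \<noteq> 0"
    and b_row_n: "\<And>j. j < n \<Longrightarrow> b n j = 0"
    and c_row_n: "\<And>j. j < n \<Longrightarrow> c n j = 0"
    and j: "j \<le> n"
  shows "b (Suc n) j = 0" and "c (Suc n) j = 0"
proof -
  have d_eq_c: "d n j = c n j" if "j \<le> n" for j
    using that c_col0[of n] c_col[of n "j - 1"] c_row_n[of "j - 1"] by (cases j) auto
  have b0: "b (Suc n) j = 0" if "j \<le> n" for j
    using that b_row[of n j] d_eq_c[OF that] b_row_n[of j] c_row_n[of j] nz[of n] \<alpha>[of n]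
    by (cases "j = n") auto
  show "b (Suc n) j = 0" using b0 j .
  \<comment> \<open>As \<open>\<alpha> j\<close> is nonzero, the column recurrence of \<open>b\<close> can be solved for \<open>e\<close>. For \<open>j = n\<close> the
    result need not vanish, and the value of \<open>\<beta> n\<close> is what cancels it in \<open>c\<close>.\<close>
  have "\<alpha> j \<noteq> 0" using nz[OF j] \<alpha>[of j] by simp
  then have e: "e (Suc n) j = - b (Suc n) (Suc j) / \<alpha> j"
    using b_col[of "Suc n" j] b0[OF j] by (simp add: field_simps)
  show "c (Suc n) j = 0"
  proof (cases "j = n")
    case True
    then show ?thesis
      using c_row[of n n] e \<alpha>[of n] \<beta>[of n] nz[of n] by simp
  next
    case False
    then show ?thesis
      using c_row[of n j] e b0[of "Suc j"] c_row_n[of j] j by simp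
  qed
qed

text \<open>
  In the application, \<open>b i j = \<langle>R\<^sub>i*, L R\<^sub>j\<rangle>\<close>, \<open>c i j = \<langle>L\<^sup>T P\<^sub>i*, L P\<^sub>j\<rangle>\<close>,
  \<open>d i j = \<langle>L\<^sup>T P\<^sub>i*, L R\<^sub>j\<rangle>\<close> and \<open>e i j = \<langle>L\<^sup>T R\<^sub>i*, L P\<^sub>j\<rangle>\<close>.
\<close>

lemma biconjugacy:
  fixes b c d e :: "nat \<Rightarrow> nat \<Rightarrow> real" and \<alpha> \<beta> :: "nat \<Rightarrow> real"
  assumes b_row: "\<And>i j. b (Suc i) j = b i j - \<alpha> i * d i j"
    and b_col: "\<And>i j. b i (Suc j) = b i j - \<alpha> j * e i j"
    and c_row0: "\<And>j. c 0 j = e 0 j"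
    and c_row: "\<And>i j. c (Suc i) j = e (Suc i) j + \<beta> i * c i j"
    and c_col0: "\<And>i. c i 0 = d i 0"
    and c_col: "\<And>i j. c i (Suc j) = d i (Suc j) + \<beta> j * c i j"
    and \<alpha>: "\<And>i. \<alpha> i = b i i / c i i"
    and \<beta>: "\<And>i. \<beta> i = b (Suc i) (Suc i) / b i i"
    and nz: "\<And>i. i < n \<Longrightarrow> b i i \<noteq> 0 \<and> c i i \<noteq> 0"
    and ij: "i \<le> n" "j \<le> n" "i \<noteq> j"
  shows "b i j = 0 \<and> c i j = 0"
  using nz ij
proof (induction n arbitrary: i j)
  case 0
  then show ?case by simp
next
  case (Suc n)
  have IH: "b i j = 0 \<and> c i j = 0" if "i \<le> n" "j \<le> n" "i \<noteq> j" for i j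
    using Suc.IH Suc.prems(1) that by simp
  have nz: "b i i \<noteq> 0 \<and> c i i \<noteq> 0" if "i \<le> n" for i
    using Suc.prems(1) that by simp
  have row: "b (Suc n) j = 0 \<and> c (Suc n) j = 0" if "j \<le> n" for j
    using biconjugacy_new_row[where b = b and c = c, OF b_row b_col c_row c_col0 c_col \<alpha> \<beta> nz _ _ that]
      IH[of n] by simp
  have col: "b j (Suc n) = 0 \<and> c j (Suc n) = 0" if "j \<le> n" for j
    using biconjugacy_new_row[where b = "\<lambda>i j. b j i" and c = "\<lambda>i j. c j i",
        OF b_col b_row c_col c_row0 c_row \<alpha> \<beta> nz _ _ that] IH[of _ n] by simp
  show ?case
    using IH[of i j] row[of j] col[of i] Suc.prems(2-4) by (cases "i = Suc n"; cases "j = Suc n") auto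
qed

section \<open>The length of a biorthogonal system\<close>

text \<open>
  If there were more vectors than coordinates, padding both coordinate matrices with zeros to
  \<open>m \<times> m\<close> matrices would not change their product, which is diagonal with nonzero diagonal,
  although the padded left factor has a zero column and so determinant \<open>0\<close>.
\<close>

lemma biorthogonal_card_le:
  fixes u v :: "nat \<Rightarrow> 'a \<Rightarrow> real"
  assumes fin: "finite S"
    and off: "\<And>i j. i < m \<Longrightarrow> j < m \<Longrightarrow> i \<noteq> j \<Longrightarrow> (\<Sum>x\<in>S. u i x * v j x) = 0"
    and diag: "\<And>i. i < m \<Longrightarrow> (\<Sum>x\<in>S. u i x * v i x) \<noteq> 0"
  shows "m \<le> card S"
proof (rule ccontr)
  define k where "k = card S"
  assume "\<not> m \<le> card S"
  then have km: "k < m" by (simp add: k_def)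
  obtain x where x: "bij_betw x {0..<k} S"
    using ex_bij_betw_nat_finite[OF fin] unfolding k_def by blast
  define U where "U = mat m m (\<lambda>(i, l). if l < k then u i (x l) else 0)"
  define V where "V = mat m m (\<lambda>(l, j). if l < k then v j (x l) else 0)"
  have U: "U \<in> carrier_mat m m" and V: "V \<in> carrier_mat m m"
    by (simp_all add: U_def V_def)
  have entry: "(U * V) $$ (i, j) = (\<Sum>y\<in>S. u i y * v j y)" if "i < m" "j < m" for i j
  proof -
    have "(U * V) $$ (i, j) = (\<Sum>l\<in>{0..<m}. if l < k then u i (x l) * v j (x l) else 0)"
      using that by (auto simp: U_def V_def scalar_prod_def intro!: sum.cong)
    also have "\<dots> = (\<Sum>l\<in>{0..<k}. u i (x l) * v j (x l))"
      using km by (intro sum.mono_neutral_cong_right) auto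
    also have "\<dots> = (\<Sum>y\<in>S. u i y * v j y)"
      by (rule sum.reindex_bij_betw[OF x])
    finally show ?thesis .
  qed
  have "upper_triangular (U * V)"
    using U V by (auto simp: entry off simp del: index_mult_mat(1))
  then have "det (U * V) = prod_list (diag_mat (U * V))"
    using U V by (intro det_upper_triangular[where n = m]) auto
  moreover have "prod_list (diag_mat (U * V)) \<noteq> 0"
    using U V by (auto simp: prod_list_zero_iff diag_mat_def entry diag simp del: index_mult_mat(1))
  moreover have "U *\<^sub>v unit_vec m k = 0\<^sub>v m"
    using km by (intro eq_vecI) (auto simp: U_def)
  then have "det U = 0"
    using det_0_iff_vec_prod_zero[OF U] km by (metis unit_vec_carrier unit_vec_nonzero)
  ultimately show False
    using det_mult[OF U V] by simp
qed

section \<open>Tensors and the Sylvester operator\<close>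

definition square_modes :: "nat \<Rightarrow> (nat \<Rightarrow> nat) \<Rightarrow> (nat \<Rightarrow> real mat) \<Rightarrow> bool" where
  "square_modes N I A \<longleftrightarrow> (\<forall>n\<in>{1..N}. A n \<in> carrier_mat (I n) (I n))"

lemma square_modesD: "square_modes N I A \<Longrightarrow> n \<in> {1..N} \<Longrightarrow> A n \<in> carrier_mat (I n) (I n)"
  by (simp add: square_modes_def)

lemma square_modes_transpose: "square_modes N I A \<Longrightarrow> square_modes N I (\<lambda>n. transpose_mat (A n))"
  by (simp add: square_modes_def)

lemma finite_tindex [simp]: "finite (tindex N I)"
  by (simp add: tindex_def finite_PiE)

lemma card_tindex: "card (tindex N I) = (\<Prod>k=1..N. I k)"
  by (simp add: tindex_def card_PiE)

lemma tindex_update: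
  "i \<in> tindex N I \<Longrightarrow> n \<in> {1..N} \<Longrightarrow> k < I n \<Longrightarrow> i(n := k) \<in> tindex N I"
  by (auto simp: tindex_def PiE_iff extensional_def)

lemma tindex_less: "i \<in> tindex N I \<Longrightarrow> n \<in> {1..N} \<Longrightarrow> i n < I n"
  by (auto simp: tindex_def PiE_iff)

lemma sylv_in_tensors: "sylv N I A X \<in> tensors N I"
  by (simp add: sylv_def tensors_def)

lemma tadd_in_tensors: "tadd N I X Y \<in> tensors N I"
  by (simp add: tadd_def tensors_def)

lemma tinner_tadd_tscale_left:
  "tinner N I (tadd N I X (tscale N I c Y)) Z = tinner N I X Z + c * tinner N I Y Z"
  by (simp add: tinner_def tadd_def tscale_def sum.distrib sum_distrib_left algebra_simps)

lemma tinner_tadd_tscale_right: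
  "tinner N I Z (tadd N I X (tscale N I c Y)) = tinner N I Z X + c * tinner N I Z Y"
  by (simp add: tinner_def tadd_def tscale_def sum.distrib sum_distrib_left algebra_simps)

lemma tdiff_eq_tadd: "tdiff N I X (tscale N I c Y) = tadd N I X (tscale N I (- c) Y)"
  by (auto simp: tdiff_def tadd_def tscale_def)

lemma sylvT_eq_sylv: "sylvT N I A = sylv N I (\<lambda>n. transpose_mat (A n))"
  by (simp add: sylvT_def sylv_def fun_eq_iff)

lemma sylv_apply:
  assumes A: "square_modes N I A"
    and i: "i \<in> tindex N I"
  shows "sylv N I A X i = (\<Sum>n=1..N. \<Sum>k<I n. X (i(n := k)) * A n $$ (i n, k))"
proof -
  have "mode_prod N I X n (A n) i = (\<Sum>k<I n. X (i(n := k)) * A n $$ (i n, k))"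
    if "n \<in> {1..N}" for n
  proof -
    have "dim_row (A n) = I n" using square_modesD[OF A that] by simp
    then show ?thesis using i by (simp add: mode_prod_def)
  qed
  then show ?thesis using i by (simp add: sylv_def)
qed

lemma sylv_linear:
  assumes A: "square_modes N I A"
  shows "sylv N I A (tadd N I X (tscale N I c Y)) =
         tadd N I (sylv N I A X) (tscale N I c (sylv N I A Y))" (is "?l = ?r")
proof
  fix i
  show "?l i = ?r i"
  proof (cases "i \<in> tindex N I")
    case True
    have "?l i = (\<Sum>n=1..N. \<Sum>k<I n.
        X (i(n := k)) * A n $$ (i n, k) + c * (Y (i(n := k)) * A n $$ (i n, k)))"
      by (simp only: sylv_apply[OF A True], intro sum.cong refl)
        (simp add: tadd_def tscale_def tindex_update[OF True] algebra_simps)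
    also have "\<dots> = ?r i"
      using True by (simp add: tadd_def tscale_def sylv_apply[OF A True] sum.distrib sum_distrib_left)
    finally show ?thesis .
  next
    case False
    then show ?thesis by (simp add: sylv_def tadd_def)
  qed
qed

text \<open>
  Both sides are sums, over a mode \<open>n\<close> and over two multi-indices that differ at most in that mode, of
  the same products. Such a pair is stored as one multi-index \<open>i\<close> and the other entry \<open>k\<close>, and
  exchanging the roles of the two is the involution \<open>(i, k) \<mapsto> (i(n := k), i n)\<close>.
\<close>

lemma tinner_sylvT_adjoint:
  assumes A: "square_modes N I A"
  shows "tinner N I (sylvT N I A X) Y = tinner N I X (sylv N I A Y)"
proof -
  note AT = square_modes_transpose[OF A]
  have swap: "(\<Sum>i\<in>tindex N I. \<Sum>k<I n. X (i(n := k)) * A n $$ (k, i n) * Y i) =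
      (\<Sum>i\<in>tindex N I. \<Sum>k<I n. X i * (Y (i(n := k)) * A n $$ (i n, k)))"
    if n: "n \<in> {1..N}" for n
    unfolding sum.cartesian_product
    by (rule sum.reindex_bij_witness[where i = "\<lambda>(i, k). (i(n := k), i n)"
          and j = "\<lambda>(i, k). (i(n := k), i n)"])
      (use n in \<open>auto simp: tindex_update tindex_less\<close>)
  have "tinner N I (sylvT N I A X) Y =
      (\<Sum>i\<in>tindex N I. \<Sum>n=1..N. \<Sum>k<I n. X (i(n := k)) * A n $$ (k, i n) * Y i)"
    unfolding tinner_def sylvT_eq_sylv
  proof (rule sum.cong[OF refl])
    fix i assume i: "i \<in> tindex N I"
    have "transpose_mat (A n) $$ (i n, k) = A n $$ (k, i n)" if "n \<in> {1..N}" "k < I n" for n k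
      using square_modesD[OF A that(1)] tindex_less[OF i that(1)] that(2) by simp
    then show "sylv N I (\<lambda>n. transpose_mat (A n)) X i * Y i =
        (\<Sum>n=1..N. \<Sum>k<I n. X (i(n := k)) * A n $$ (k, i n) * Y i)"
      by (simp only: sylv_apply[OF AT i] sum_distrib_right)
        (intro sum.cong refl, simp)
  qed
  also have "\<dots> = (\<Sum>n=1..N. \<Sum>i\<in>tindex N I. \<Sum>k<I n. X (i(n := k)) * A n $$ (k, i n) * Y i)"
    by (rule sum.swap)
  also have "\<dots> = (\<Sum>n=1..N. \<Sum>i\<in>tindex N I. \<Sum>k<I n. X i * (Y (i(n := k)) * A n $$ (i n, k)))"
    using swap by (rule sum.cong[OF refl])
  also have "\<dots> = (\<Sum>i\<in>tindex N I. \<Sum>n=1..N. \<Sum>k<I n. X i * (Y (i(n := k)) * A n $$ (i n, k)))"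
    by (rule sum.swap)
  also have "\<dots> = tinner N I X (sylv N I A Y)"
    unfolding tinner_def
    by (rule sum.cong[OF refl]) (simp add: sylv_apply[OF A] sum_distrib_left)
  finally show ?thesis .
qed

section \<open>The TBiCOR iteration\<close>

lemma tbicor_0: "tbicor N I A D X0 0 = tbicor_init N I A D X0"
  by (simp add: tbicor_def)

lemma tbicor_Suc: "tbicor N I A D X0 (Suc n) = tbicor_step N I A (tbicor N I A D X0 n)"
  by (simp add: tbicor_def)

lemma iterX_in_tensors: "X0 \<in> tensors N I \<Longrightarrow> iterX (tbicor N I A D X0 n) \<in> tensors N I"
  by (cases n)
    (simp_all add: tbicor_0 tbicor_Suc tbicor_init_def tbicor_step_def Let_def tadd_in_tensors)

lemma resR_eq_residual:
  assumes A: "square_modes N I A"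
  shows "resR (tbicor N I A D X0 n) = tdiff N I D (sylv N I A (iterX (tbicor N I A D X0 n)))"
proof (induction n)
  case 0
  then show ?case by (simp add: tbicor_0 tbicor_init_def Let_def)
next
  case (Suc n)
  have assoc: "tdiff N I (tdiff N I D Y) (tscale N I c Z) = tdiff N I D (tadd N I Y (tscale N I c Z))"
    for c Y Z
    by (rule ext) (simp add: tdiff_def tadd_def tscale_def)
  show ?case
    by (simp add: tbicor_Suc tbicor_step_def Let_def sylv_linear[OF A] Suc assoc)
qed

lemma solution_if_converged:
  assumes D: "D \<in> tensors N I"
    and A: "square_modes N I A"
    and X0: "X0 \<in> tensors N I"
    and conv: "tbicor_converged N I A D X0 n"
  shows "sylv_solution N I A D (iterX (tbicor N I A D X0 n))"
proof -
  let ?X = "iterX (tbicor N I A D X0 n)"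
  have "tdiff N I D (sylv N I A ?X) = tzero N I"
    using conv resR_eq_residual[OF A, where D = D and ?X0.0 = X0 and n = n] by (simp add: tbicor_converged_def)
  then have "D i - sylv N I A ?X i = 0" if "i \<in> tindex N I" for i
    using that by (auto simp: tdiff_def tzero_def dest: fun_cong[where x = i])
  then have "sylv N I A ?X = D"
    using D sylv_in_tensors[of N I A ?X]
    by (intro PiE_ext[of _ "tindex N I" "\<lambda>_. UNIV"]) (auto simp: tensors_def)
  then show ?thesis
    using iterX_in_tensors[OF X0] by (simp add: sylv_solution_def)
qed

text \<open>
  The residuals of step \<open>n\<close> are produced by pass \<open>n - 1\<close>, so nonzero divisors are required of the passes
  before \<open>n\<close> only.
\<close>

lemma tbicor_biorthogonal:
  assumes A: "square_modes N I A"
    and nz: "\<And>i. i < n \<Longrightarrow> innerRT N I A (tbicor N I A D X0 i) \<noteq> 0 \<and>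
                         innerSS N I A (tbicor N I A D X0 i) \<noteq> 0"
    and ij: "i \<le> n" "j \<le> n" "i \<noteq> j"
  shows "tinner N I (resR' (tbicor N I A D X0 i)) (sylv N I A (resR (tbicor N I A D X0 j))) = 0"
proof -
  define s where "s = tbicor N I A D X0"
  define R where "R n = resR (s n)" for n
  define R' where "R' n = resR' (s n)" for n
  define P where "P n = dirP N I (s n)" for n
  define P' where "P' n = dirP' N I (s n)" for n
  define b where "b i j = tinner N I (R' i) (sylv N I A (R j))" for i j
  define c where "c i j = tinner N I (sylvT N I A (P' i)) (sylv N I A (P j))" for i j
  define d where "d i j = tinner N I (sylvT N I A (P' i)) (sylv N I A (R j))" for i j
  define e where "e i j = tinner N I (sylvT N I A (R' i)) (sylv N I A (P j))" for i j
  define \<alpha> where "\<alpha> i = b i i / c i i" for i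
  define \<beta> where "\<beta> i = b (Suc i) (Suc i) / b i i" for i
  note AT = square_modes_transpose[OF A]
  have RT: "innerRT N I A (s n) = b n n" for n
    by (simp add: innerRT_def b_def R_def R'_def)
  have SS: "innerSS N I A (s n) = c n n" for n
    by (simp add: innerSS_def c_def P_def P'_def)
  have s_Suc: "s (Suc n) = tbicor_step N I A (s n)" for n
    by (simp add: s_def tbicor_Suc)
  have R_Suc: "R (Suc n) = tadd N I (R n) (tscale N I (- \<alpha> n) (sylv N I A (P n)))" for n
    by (simp add: R_def s_Suc tbicor_step_def Let_def tdiff_eq_tadd RT SS \<alpha>_def P_def)
  have R'_Suc: "R' (Suc n) = tadd N I (R' n) (tscale N I (- \<alpha> n) (sylvT N I A (P' n)))" for n
    by (simp add: R'_def s_Suc tbicor_step_def Let_def tdiff_eq_tadd RT SS \<alpha>_def P'_def)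
  have \<beta>_Suc: "prev\<beta> (s (Suc n)) = \<beta> n" for n
  proof -
    have "prev\<beta> (s (Suc n)) = innerRT N I A (s (Suc n)) / innerRT N I A (s n)"
      by (simp add: s_Suc tbicor_step_def Let_def innerRT_def)
    then show ?thesis by (simp add: RT \<beta>_def)
  qed
  have prevP: "prevP (s (Suc n)) = P n" "prevP' (s (Suc n)) = P' n" for n
    by (simp_all add: s_Suc tbicor_step_def Let_def P_def P'_def)
  have P_Suc: "P (Suc n) = tadd N I (R (Suc n)) (tscale N I (\<beta> n) (P n))" for n
    by (subst P_def) (simp add: dirP_def \<beta>_Suc prevP R_def)
  have P'_Suc: "P' (Suc n) = tadd N I (R' (Suc n)) (tscale N I (\<beta> n) (P' n))" for n
    by (subst P'_def) (simp add: dirP'_def \<beta>_Suc prevP R'_def)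
  \<comment> \<open>Keeping the zero summand gives step \<open>0\<close> the same form as the later ones, so that the
    same linearity rules apply.\<close>
  have P_0: "P 0 = tadd N I (R 0) (tscale N I 0 (tzero N I))"
    by (simp add: P_def R_def dirP_def s_def tbicor_0 tbicor_init_def Let_def)
  have P'_0: "P' 0 = tadd N I (R' 0) (tscale N I 0 (tzero N I))"
    by (simp add: P'_def R'_def dirP'_def s_def tbicor_0 tbicor_init_def Let_def)
  note bilinear = sylv_linear[OF A] sylv_linear[OF AT] tinner_tadd_tscale_left
    tinner_tadd_tscale_right
  have "b i j = 0 \<and> c i j = 0"
  proof (rule biconjugacy[of b \<alpha> d e c \<beta> n])
    show "b (Suc i) j = b i j - \<alpha> i * d i j" for i j
      by (simp add: b_def d_def R'_Suc bilinear)
    \<comment> \<open>Here linearity gives \<open>\<langle>R\<^sub>i*, L (L P\<^sub>j)\<rangle>\<close>, which only the adjoint identifies with \<open>e i j\<close>.\<close>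
    show "b i (Suc j) = b i j - \<alpha> j * e i j" for i j
      by (simp add: b_def e_def R_Suc bilinear tinner_sylvT_adjoint[OF A])
    show "c 0 j = e 0 j" for j
      by (simp add: c_def e_def P'_0 sylvT_eq_sylv bilinear)
    show "c (Suc i) j = e (Suc i) j + \<beta> i * c i j" for i j
      by (simp add: c_def e_def P'_Suc sylvT_eq_sylv bilinear)
    show "c i 0 = d i 0" for i
      by (simp add: c_def d_def P_0 bilinear)
    show "c i (Suc j) = d i (Suc j) + \<beta> j * c i j" for i j
      by (simp add: c_def d_def P_Suc bilinear)
    show "b i i \<noteq> 0 \<and> c i i \<noteq> 0" if "i < n" for i
      using nz[OF that] by (simp add: RT SS flip: s_def)
  qed (simp_all add: \<alpha>_def \<beta>_def ij)
  then show ?thesis by (simp add: b_def R_def R'_def s_def)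
qed

theorem theorem1:
  fixes N :: nat and I :: "nat \<Rightarrow> nat" and A :: "nat \<Rightarrow> real mat" and D X0 :: tensor
  assumes "D \<in> tensors N I"
    and "\<And>n. n \<in> {1..N} \<Longrightarrow> A n \<in> carrier_mat (I n) (I n)"
    and "sylv_consistent N I A D"
    and "X0 \<in> tensors N I"
    and "tbicor_no_breakdown N I A D X0"
  shows "\<exists>n \<le> (\<Prod>k=1..N. I k).
           tbicor_converged N I A D X0 n \<and>
           (\<forall>m<n. \<not> tbicor_converged N I A D X0 m) \<and>
           sylv_solution N I A D (iterX (tbicor N I A D X0 n))"
proof -
  let ?conv = "tbicor_converged N I A D X0"
  have A: "square_modes N I A"
    using assms(2) by (simp add: square_modes_def)
  define M where "M = (\<Prod>k=1..N. I k)"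
  have "\<exists>n\<le>M. ?conv n"
  proof (rule ccontr)
    assume "\<not> (\<exists>n\<le>M. ?conv n)"
    then have nz: "innerRT N I A (tbicor N I A D X0 n) \<noteq> 0 \<and>
        innerSS N I A (tbicor N I A D X0 n) \<noteq> 0" if "n \<le> M" for n
      using assms(5) that by (auto simp: tbicor_no_breakdown_def)
    define u where "u i = resR' (tbicor N I A D X0 i)" for i
    define v where "v j = sylv N I A (resR (tbicor N I A D X0 j))" for j
    have "Suc M \<le> card (tindex N I)"
    proof (rule biorthogonal_card_le[of _ _ u v])
      show "(\<Sum>x\<in>tindex N I. u i x * v j x) = 0" if "i < Suc M" "j < Suc M" "i \<noteq> j" for i j
        using tbicor_biorthogonal[OF A, where n = M and D = D and ?X0.0 = X0 and i = i and j = j] nz that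
        by (simp add: u_def v_def tinner_def)
      show "(\<Sum>x\<in>tindex N I. u i x * v i x) \<noteq> 0" if "i < Suc M" for i
        using nz[of i] that by (simp add: u_def v_def innerRT_def tinner_def)
    qed simp
    then show False by (simp add: card_tindex M_def)
  qed
  then obtain n where n: "n \<le> M" "?conv n" by blast
  have least: "?conv (LEAST n. ?conv n)" using n(2) by (rule LeastI)
  show ?thesis
  proof (intro exI conjI)
    show "(LEAST n. ?conv n) \<le> (\<Prod>k=1..N. I k)"
      using Least_le[of ?conv n] n by (simp add: M_def)
    show "\<forall>m<LEAST n. ?conv n. \<not> ?conv m"
      using not_less_Least by blast
    show "sylv_solution N I A D (iterX (tbicor N I A D X0 (LEAST n. ?conv n)))"
      using solution_if_converged[OF assms(1) A assms(4) least] by simp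
  qed (rule least)
qed

end
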